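(* Let $T>0$, $L>0$ and $g\in\mathbf R_T^L$. Then the function $$r\mapsto\frac{e^{\frac r{4T}}g(r)}{\ln\left(1+\frac{4T}r\right)},\quad r\in\mathbb R_+,$$ belongs to $L^\infty(\mathbb R_+)$, and its $L^\infty(\mathbb R_+)$ norm is at most $\frac L{2\pi}$.
   Context: $\mathbb R_+=(0,+\infty)$. $\mathbf R_T^L$ is the set of all functions $Y\in L^2(\mathbb R_+)$ for which there is $u\in L^\infty(0,T)$ with $\|u\|_{L^\infty(0,T)}\le L$ such that $$Y(r)=-\frac1\pi\int_0^T\frac1{2\xi}e^{-\frac r{4\xi}}u(T-\xi)\,d\xi,\quad r\in\mathbb R_+.$$ *)

theory Defs
  imports "HOL-Probability.Essential_Supremum"
begin

text \<open>Elements of \<open>L\<^sup>2\<close> and \<open>L\<^sup>\<infinity>\<close> are represented by Lebesgue measurable functions, and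
  equations between them hold almost everywhere. The spaces over an interval \<open>S\<close> of the real line
  are taken with respect to \<^term>\<open>lebesgue_on S\<close>, so values outside \<open>S\<close> are irrelevant.
  Nonmeasurable functions get \<^term>\<open>esssup\<close> equal to \<open>\<infinity>\<close>.\<close>

definition L2 :: "real measure \<Rightarrow> (real \<Rightarrow> real) set" where
  "L2 M = {f \<in> borel_measurable M. integrable M (\<lambda>x. (f x)\<^sup>2)}"

definition Linf_norm :: "real measure \<Rightarrow> (real \<Rightarrow> real) \<Rightarrow> ereal" where
  "Linf_norm M f = esssup M (\<lambda>x. ereal \<bar>f x\<bar>)"

definition Linf :: "real measure \<Rightarrow> (real \<Rightarrow> real) set" where
  "Linf M = {f \<in> borel_measurable M. Linf_norm M f < \<infinity>}"

definition R_set :: "real \<Rightarrow> real \<Rightarrow> (real \<Rightarrow> real) set" where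
  "R_set T L = {Y \<in> L2 (lebesgue_on {0<..}).
     \<exists>u \<in> Linf (lebesgue_on {0<..<T}).
       Linf_norm (lebesgue_on {0<..<T}) u \<le> ereal L \<and>
       (AE r in lebesgue_on {0<..}.
          Y r = - (1 / pi) *
            (\<integral>\<xi>. 1 / (2 * \<xi>) * exp (- r / (4 * \<xi>)) * u (T - \<xi>) \<partial>lebesgue_on {0<..<T}))}"

end

theory Submission
  imports Defs "HOL-Real_Asymp.Real_Asymp"
begin

text \<open>Up to the factor \<open>L / (2\<pi>)\<close>, the function \<open>g\<close> is bounded by the integral of
  \<open>e\<^bsup>-r/(4\<xi>)\<^esup> / \<xi>\<close> over \<open>(0,T)\<close>, which is the exponential integral \<open>E\<^sub>1(r/(4T))\<close>. The classical
  estimate \<open>E\<^sub>1(x) \<le> e\<^bsup>-x\<^esup> ln (1 + 1/x)\<close> then gives the claim. It holds because the function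
  \<open>e\<^bsup>-r/(4\<xi>)\<^esup> ln (1 + 4\<xi>/r)\<close> vanishes as \<open>\<xi> \<rightarrow> 0\<close> and its derivative in \<open>\<xi>\<close> dominates the integrand,
  by \<open>ln (1 + 1/x) \<ge> 1/(1 + x)\<close>.\<close>

text \<open>This is the \<xi>-derivative of
  \<open>exp (- r / (4 * \<xi>)) * ln (1 + 4 * \<xi> / r)\<close>, written out by the product rule,
  so its integral is explicit.\<close>

definition majorant :: "real \<Rightarrow> real \<Rightarrow> real" where
  "majorant r \<xi> = exp (- r / (4 * \<xi>)) * (r / (4 * \<xi>\<^sup>2) * ln (1 + 4 * \<xi> / r) + 4 / (r + 4 * \<xi>))"

lemma majorant_ge:
  assumes "r > 0" and "\<xi> > 0"
  shows "1 / \<xi> * exp (- r / (4 * \<xi>)) \<le> majorant r \<xi>"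
proof -
  \<comment> \<open>The bound ln y \<le> y - 1 is taken at the reciprocal of
    \<open>1 + 4 * \<xi> / r\<close>; the sign change under inversion turns it into a lower bound
    for the logarithm.\<close>
  have "ln (r / (r + 4 * \<xi>)) \<le> r / (r + 4 * \<xi>) - 1"
    using assms by (intro ln_le_minus_one) auto
  moreover have "ln (1 + 4 * \<xi> / r) = - ln (r / (r + 4 * \<xi>))"
  proof -
    have "1 + 4 * \<xi> / r = inverse (r / (r + 4 * \<xi>))"
      using assms by (simp add: field_simps)
    then show ?thesis
      using assms by (simp only: ln_inverse)
  qed
  ultimately have "1 - r / (r + 4 * \<xi>) \<le> ln (1 + 4 * \<xi> / r)"
    by simp
  then have "r / (4 * \<xi>\<^sup>2) * (1 - r / (r + 4 * \<xi>)) + 4 / (r + 4 * \<xi>)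
      \<le> r / (4 * \<xi>\<^sup>2) * ln (1 + 4 * \<xi> / r) + 4 / (r + 4 * \<xi>)"
    using assms by (intro add_right_mono mult_left_mono) auto
  \<comment> \<open>With the logarithm replaced by its lower bound, the bracket of
    \<open>majorant\<close> collapses to exactly the singular factor of the kernel.\<close>
  moreover have "r / (4 * \<xi>\<^sup>2) * (1 - r / (r + 4 * \<xi>)) + 4 / (r + 4 * \<xi>) = 1 / \<xi>"
  proof -
    have "r + 4 * \<xi> \<noteq> 0"
      using assms by auto
    then have "1 - r / (r + 4 * \<xi>) = 4 * \<xi> / (r + 4 * \<xi>)"
      by (simp add: field_simps)
    then have "r / (4 * \<xi>\<^sup>2) * (1 - r / (r + 4 * \<xi>)) = r / (\<xi> * (r + 4 * \<xi>))"
      using assms by (simp add: power2_eq_square)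
    also have "\<dots> + 4 / (r + 4 * \<xi>) = (r + 4 * \<xi>) / (\<xi> * (r + 4 * \<xi>))"
      using assms by (simp add: add_divide_distrib)
    finally show ?thesis
      using \<open>r + 4 * \<xi> \<noteq> 0\<close> by simp
  qed
  ultimately have "exp (- r / (4 * \<xi>)) * (1 / \<xi>) \<le> majorant r \<xi>"
    unfolding majorant_def by (intro mult_left_mono) simp_all
  then show ?thesis
    by (simp only: mult.commute)
qed

lemma majorant_nonneg:
  assumes "r > 0" and "\<xi> > 0"
  shows "0 \<le> majorant r \<xi>"
  by (rule order_trans[OF _ majorant_ge[OF assms]]) (use assms in simp)

lemma majorant_antiderivative:
  assumes "r > 0" and "\<xi> > 0"
  shows "((\<lambda>\<xi>. exp (- r / (4 * \<xi>)) * ln (1 + 4 * \<xi> / r)) has_real_derivative majorant r \<xi>) (at \<xi>)"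
proof -
  have "1 + 4 * \<xi> / r > 0"
    using assms by (simp add: add_pos_pos)
  moreover have "(4 / r) / (1 + 4 * \<xi> / r) = 4 / (r + 4 * \<xi>)"
    using assms by (simp add: field_simps)
  ultimately show ?thesis
    unfolding majorant_def using assms
    by (auto intro!: derivative_eq_intros simp: power2_eq_square algebra_simps)
qed

text \<open>Since \<open>majorant r\<close> is nonnegative on (0,T), the fundamental theorem of
  calculus yields integrability and the value together, from the one-sided limits of the
  antiderivative at the endpoints.\<close>

lemma majorant_integral:
  assumes "r > 0" and "T > 0"
  shows majorant_integrable: "integrable (lebesgue_on {0<..<T}) (majorant r)"
    and integral_majorant:
      "(\<integral>\<xi>. majorant r \<xi> \<partial>lebesgue_on {0<..<T}) = exp (- r / (4 * T)) * ln (1 + 4 * T / r)"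
proof -
  let ?F = "\<lambda>\<xi>. exp (- r / (4 * \<xi>)) * ln (1 + 4 * \<xi> / r)"
  have cont: "isCont (majorant r) \<xi>" if "\<xi> > 0" for \<xi>
  proof -
    have "1 + 4 * \<xi> / r > 0" "r + 4 * \<xi> > 0"
      using assms that by (simp_all add: add_pos_pos)
    then show ?thesis
      unfolding majorant_def using assms that by (intro continuous_intros) auto
  qed
  \<comment> \<open>Both factors vanish in the limit: the exponent tends to -\<infinity> and the
    logarithm to ln 1.\<close>
  have at_0: "((?F \<circ> real_of_ereal) \<longlongrightarrow> 0) (at_right (ereal 0))"
    unfolding ereal_tendsto_simps using assms by real_asymp
  have "isCont ?F T"
    using majorant_antiderivative[OF assms] by (rule DERIV_isCont)
  then have at_T: "((?F \<circ> real_of_ereal) \<longlongrightarrow> ?F T) (at_left (ereal T))"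
    unfolding ereal_tendsto_simps isCont_def by (rule filterlim_mono) (simp_all add: at_le)
  have FTC: "set_integrable lborel {0<..<T} (majorant r)"
    "(LBINT \<xi>=ereal 0..ereal T. majorant r \<xi>) = ?F T - 0"
    using interval_integral_FTC_nonneg[where a = "ereal 0" and b = "ereal T" and F = ?F,
        OF _ majorant_antiderivative cont _ at_0 at_T] assms majorant_nonneg
    by auto
  \<comment> \<open>Measurability for \<open>lborel\<close> lets integrals over its completion
    \<open>lebesgue\<close> be computed in \<open>lborel\<close>.\<close>
  have meas: "(\<lambda>\<xi>. indicator {0<..<T} \<xi> *\<^sub>R majorant r \<xi>) \<in> borel_measurable lborel"
    using FTC(1) unfolding set_integrable_def by auto
  show "integrable (lebesgue_on {0<..<T}) (majorant r)"
    using FTC(1) meas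
    by (simp add: integrable_restrict_space integrable_completion set_integrable_def)
  show "(\<integral>\<xi>. majorant r \<xi> \<partial>lebesgue_on {0<..<T}) = exp (- r / (4 * T)) * ln (1 + 4 * T / r)"
    using FTC(2) meas assms
    by (simp add: integral_restrict_space integral_completion interval_lebesgue_integral_def
        set_lebesgue_integral_def)
qed

text \<open>The exceptional set need not be Borel, so it is enclosed in a Borel null set
  \<open>N\<close>, whose affine preimage is again null. This serves to carry the bound on u over to
  \<xi> \<mapsto> u (T - \<xi>).\<close>

lemma AE_lebesgue_affine:
  fixes P :: "real \<Rightarrow> bool"
  assumes "c \<noteq> 0" and "AE x in lebesgue. P x"
  shows "AE x in lebesgue. P (t + c * x)"
proof -
  have "AE x in lborel. P x"
    using assms(2) by (simp add: AE_completion_iff)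
  then obtain N where N: "N \<in> null_sets lborel" and P: "{x \<in> space lborel. \<not> P x} \<subseteq> N"
    unfolding eventually_ae_filter by auto
  have "AE x in lborel. t + c * x \<notin> N"
  proof (rule AE_borel_affine[OF assms(1)])
    show "Measurable.pred borel (\<lambda>x. x \<notin> N)"
      using null_setsD2[OF N] by auto
    show "AE x in lborel. x \<notin> N"
      using N by (rule AE_not_in)
  qed
  then have "AE x in lborel. P (t + c * x)"
    by eventually_elim (use P in auto)
  then show ?thesis
    by (rule AE_completion)
qed

lemma AE_abs_le_Linf_norm:
  assumes "Linf_norm M u \<le> ereal L"
  shows "AE x in M. \<bar>u x\<bar> \<le> L"
  using esssup_AE[where f = "\<lambda>x. ereal \<bar>u x\<bar>" and M = M]
proof eventually_elim
  case (elim x)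
  then have "ereal \<bar>u x\<bar> \<le> ereal L"
    using assms unfolding Linf_norm_def by (rule order_trans)
  then show ?case
    by simp
qed

lemma Linf_norm_leI:
  assumes "f \<in> borel_measurable M" and "AE x in M. \<bar>f x\<bar> \<le> C"
  shows "f \<in> Linf M" and "Linf_norm M f \<le> ereal C"
proof -
  show *: "Linf_norm M f \<le> ereal C"
    unfolding Linf_norm_def using assms by (intro esssup_I) auto
  show "f \<in> Linf M"
    using assms(1) order_le_less_trans[OF *, of \<infinity>] unfolding Linf_def by simp
qed

lemma abs_exp_kernel_integral_le:
  fixes T L r :: real
  assumes "T > 0" and "r > 0" and "L \<ge> 0" and u: "Linf_norm (lebesgue_on {0<..<T}) u \<le> ereal L"
  shows "\<bar>\<integral>\<xi>. 1 / (2 * \<xi>) * exp (- r / (4 * \<xi>)) * u (T - \<xi>) \<partial>lebesgue_on {0<..<T}\<bar>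
    \<le> L / 2 * (exp (- r / (4 * T)) * ln (1 + 4 * T / r))"
    (is "\<bar>integral\<^sup>L ?M ?f\<bar> \<le> _")
proof -
  have "AE \<xi> in lebesgue. \<xi> \<in> {0<..<T} \<longrightarrow> \<bar>u \<xi>\<bar> \<le> L"
    using AE_abs_le_Linf_norm[OF u] by (simp add: AE_restrict_space_iff)
  \<comment> \<open>The reflection \<xi> \<mapsto> T - \<xi> maps (0,T) onto itself.\<close>
  from AE_lebesgue_affine[OF _ this, of "-1" T]
  have "AE \<xi> in lebesgue. \<xi> \<in> {0<..<T} \<longrightarrow> \<bar>u (T - \<xi>)\<bar> \<le> L"
    by (simp add: conj_commute)
  then have "AE \<xi> in ?M. \<bar>u (T - \<xi>)\<bar> \<le> L"
    by (simp add: AE_restrict_space_iff)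
  moreover have pos: "AE \<xi> in ?M. \<xi> > 0"
    by (rule AE_I2) simp
  ultimately have le: "AE \<xi> in ?M. \<bar>?f \<xi>\<bar> \<le> L / 2 * majorant r \<xi>"
  proof eventually_elim
    case (elim \<xi>)
    \<comment> \<open>The kernel's 1/2 is grouped with u, which leaves the factor bounded in
      \<open>majorant_ge\<close> and gives the constant L/2.\<close>
    have "\<bar>?f \<xi>\<bar> = (1 / \<xi> * exp (- r / (4 * \<xi>))) * (\<bar>u (T - \<xi>)\<bar> / 2)"
      using elim by (simp add: abs_mult)
    also have "\<dots> \<le> majorant r \<xi> * (L / 2)"
      using elim majorant_ge[OF \<open>r > 0\<close>, of \<xi>] majorant_nonneg[OF \<open>r > 0\<close>, of \<xi>]
      by (intro mult_mono) auto
    finally show ?case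
      by (simp add: mult.commute)
  qed
  have "\<bar>integral\<^sup>L ?M ?f\<bar> \<le> (\<integral>\<xi>. \<bar>?f \<xi>\<bar> \<partial>?M)"
    by (rule integral_abs_bound)
  \<comment> \<open>A nonintegrable function has integral 0 by convention; nonnegativity of the
    majorant covers that case.\<close>
  also have "\<dots> \<le> (\<integral>\<xi>. L / 2 * majorant r \<xi> \<partial>?M)"
  proof (rule integral_mono_AE'[OF _ le])
    show "integrable ?M (\<lambda>\<xi>. L / 2 * majorant r \<xi>)"
      using majorant_integrable[OF \<open>r > 0\<close> \<open>T > 0\<close>] by simp
    show "AE \<xi> in ?M. 0 \<le> L / 2 * majorant r \<xi>"
      using pos by eventually_elim (use majorant_nonneg[OF \<open>r > 0\<close>] \<open>L \<ge> 0\<close> in simp)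
  qed
  also have "\<dots> = L / 2 * (exp (- r / (4 * T)) * ln (1 + 4 * T / r))"
    using integral_majorant[OF \<open>r > 0\<close> \<open>T > 0\<close>] by simp
  finally show ?thesis .
qed

theorem theorem4p1:
  fixes T L :: real and g :: "real \<Rightarrow> real"
  assumes "T > 0" and "L > 0" and "g \<in> R_set T L"
  shows "(\<lambda>r. exp (r / (4 * T)) * g r / ln (1 + 4 * T / r)) \<in> Linf (lebesgue_on {0<..}) \<and>
    Linf_norm (lebesgue_on {0<..}) (\<lambda>r. exp (r / (4 * T)) * g r / ln (1 + 4 * T / r))
      \<le> ereal (L / (2 * pi))"
proof -
  let ?M = "lebesgue_on {0::real<..}"
  let ?h = "\<lambda>r. exp (r / (4 * T)) * g r / ln (1 + 4 * T / r)"
  from assms(3) obtain u where g: "g \<in> borel_measurable ?M"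
    and u: "Linf_norm (lebesgue_on {0<..<T}) u \<le> ereal L"
    and eq: "AE r in ?M. g r = - (1 / pi) *
      (\<integral>\<xi>. 1 / (2 * \<xi>) * exp (- r / (4 * \<xi>)) * u (T - \<xi>) \<partial>lebesgue_on {0<..<T})"
    unfolding R_set_def L2_def by blast
  \<comment> \<open>Both functions are Borel on the whole line, hence measurable for the completion
    and then for its restriction.\<close>
  have [measurable]: "(\<lambda>r. exp (r / (4 * T))) \<in> borel_measurable ?M"
    "(\<lambda>r. ln (1 + 4 * T / r)) \<in> borel_measurable ?M"
    by (intro measurable_restrict_space1 measurable_completion; measurable)+
  have h: "?h \<in> borel_measurable ?M"
    using g by measurable
  have "AE r in ?M. r > 0"
    by (rule AE_I2) simp
  with eq have "AE r in ?M. \<bar>?h r\<bar> \<le> L / (2 * pi)"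
  proof eventually_elim
    case (elim r)
    have ln_pos: "ln (1 + 4 * T / r) > 0"
      using elim \<open>T > 0\<close> by (intro ln_gt_zero) simp
    have "\<bar>g r\<bar> = 1 / pi *
        \<bar>\<integral>\<xi>. 1 / (2 * \<xi>) * exp (- r / (4 * \<xi>)) * u (T - \<xi>) \<partial>lebesgue_on {0<..<T}\<bar>"
      unfolding elim(1) by (simp add: abs_mult)
    also have "\<dots> \<le> 1 / pi * (L / 2 * (exp (- r / (4 * T)) * ln (1 + 4 * T / r)))"
      using assms elim u by (intro mult_left_mono abs_exp_kernel_integral_le) auto
    finally have "exp (r / (4 * T)) * \<bar>g r\<bar>
        \<le> exp (r / (4 * T)) * (1 / pi * (L / 2 * (exp (- r / (4 * T)) * ln (1 + 4 * T / r))))"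
      by (rule mult_left_mono) simp
    also have "\<dots> = L / (2 * pi) * ln (1 + 4 * T / r)"
      by (simp add: exp_minus field_simps)
    finally show ?case
      using ln_pos by (simp add: abs_mult pos_divide_le_eq)
  qed
  with h show ?thesis
    using Linf_norm_leI by blast
qed

end
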